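(* Let $X$ be a real Hilbert space, let $A\colon X\rightrightarrows X$ and $B\colon X\rightrightarrows X$ be maximally monotone, and let $T=\operatorname{Id}-J_A+J_BR_A$ be the Douglas–Rachford operator associated with $(A,B)$. Set $D=\operatorname{dom}A-\operatorname{dom}B$ and $R=\operatorname{ran}A+\operatorname{ran}B$. Then the following implications hold: (i) If $A$ and $B$ are $3^*$ monotone, then $\overline{\operatorname{ran}}(\operatorname{Id}-T)=\overline{D\cap R}$. (ii) If there exists $C\in\{A,B\}$ such that $\operatorname{dom}C=X$ and $C$ is $3^*$ monotone, then $\overline{\operatorname{ran}}(\operatorname{Id}-T)=\overline{R}$. (iii) If there exists $C\in\{A,B\}$ such that $\operatorname{ran}C=X$ and $C$ is $3^*$ monotone, then $\overline{\operatorname{ran}}(\operatorname{Id}-T)=\overline{D}$.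
   Context: $X$ is a real Hilbert space (possibly infinite-dimensional) with inner product $\langle\cdot,\cdot\rangle$ and norm $\|\cdot\|$. For a set-valued operator $C\colon X\rightrightarrows X$: $\operatorname{gra}C=\{(x,u)\in X\times X : u\in Cx\}$, $\operatorname{dom}C=\{x : Cx\neq\varnothing\}$, $\operatorname{ran}C=\bigcup_{x\in X}Cx$. $C$ is monotone if $\langle x-y,u-v\rangle\ge 0$ for all $(x,u),(y,v)\in\operatorname{gra}C$, and maximally monotone if moreover no proper extension of $\operatorname{gra}C$ is the graph of a monotone operator. The resolvent is $J_C=(\operatorname{Id}+C)^{-1}$ (single-valued and defined on all of $X$ when $C$ is maximally monotone) and the reflected resolvent is $R_C=2J_C-\operatorname{Id}$. A monotone operator $C$ is $3^*$ monotone if for every $(y,z^* )\in\operatorname{dom}C\times\operatorname{ran}C$ one has $\inf_{(x,x^* )\in\operatorname{gra}C}\langle x-y,x^*-z^*\rangle>-\infty$. Sums and differences of sets are Minkowski sums and differences; overlines denote norm closures, and $\overline{\operatorname{ran}}$ is the closure of the range. *)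

theory Defs
  imports "HOL-Analysis.Analysis" "HOL-Library.Set_Algebras"
begin

text \<open>
  A set-valued operator on \<open>X\<close> is a function of type \<open>'a \<Rightarrow> 'a set\<close>.  A real Hilbert space is a
  type of sort \<open>{real_inner, complete_space}\<close>.  On sets, \<open>+\<close> is the Minkowski sum of
  \<open>HOL-Library.Set_Algebras\<close>, but \<open>-\<close> remains the set-theoretic difference, hence the separate
  definition of the Minkowski difference.
\<close>

definition minkowski_diff :: "'a::minus set \<Rightarrow> 'a set \<Rightarrow> 'a set" where
  "minkowski_diff S T = {s - t | s t. s \<in> S \<and> t \<in> T}"

definition op_graph :: "('a \<Rightarrow> 'b set) \<Rightarrow> ('a \<times> 'b) set" where
  "op_graph C = {(x, u). u \<in> C x}"

definition op_dom :: "('a \<Rightarrow> 'b set) \<Rightarrow> 'a set" where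
  "op_dom C = {x. C x \<noteq> {}}"

definition op_ran :: "('a \<Rightarrow> 'b set) \<Rightarrow> 'b set" where
  "op_ran C = (\<Union>x. C x)"

definition op_inverse :: "('a \<Rightarrow> 'b set) \<Rightarrow> 'b \<Rightarrow> 'a set" where
  "op_inverse C u = {x. u \<in> C x}"

definition monotone_op :: "('a::real_inner \<Rightarrow> 'a set) \<Rightarrow> bool" where
  "monotone_op C \<longleftrightarrow>
    (\<forall>(x, u) \<in> op_graph C. \<forall>(y, v) \<in> op_graph C. 0 \<le> (x - y) \<bullet> (u - v))"

definition maximally_monotone_op :: "('a::real_inner \<Rightarrow> 'a set) \<Rightarrow> bool" where
  "maximally_monotone_op C \<longleftrightarrow>
    monotone_op C \<and> (\<nexists>E. monotone_op E \<and> op_graph C \<subset> op_graph E)"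

text \<open>The infimum is taken in the extended reals, so that it may be \<open>-\<infinity>\<close>.\<close>

definition three_star_monotone_op :: "('a::real_inner \<Rightarrow> 'a set) \<Rightarrow> bool" where
  "three_star_monotone_op C \<longleftrightarrow>
    monotone_op C \<and>
    (\<forall>y \<in> op_dom C. \<forall>z \<in> op_ran C.
      (INF (x, u) \<in> op_graph C. ereal ((x - y) \<bullet> (u - z))) > -\<infinity>)"

text \<open>
  By Minty's theorem the set-valued operator \<open>(Id + C)\<inverse>\<close> has exactly one value at every
  point when \<open>C\<close> is maximally monotone on a Hilbert space; \<open>resolvent C\<close> is the corresponding
  function, with unspecified values where \<open>(Id + C)\<inverse>\<close> is not a singleton.
\<close>

definition resolvent :: "('a::real_inner \<Rightarrow> 'a set) \<Rightarrow> 'a \<Rightarrow> 'a" where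
  "resolvent C x = (THE y. y \<in> op_inverse (\<lambda>w. {w} + C w) x)"

definition reflected_resolvent :: "('a::real_inner \<Rightarrow> 'a set) \<Rightarrow> 'a \<Rightarrow> 'a" where
  "reflected_resolvent C x = 2 *\<^sub>R resolvent C x - x"

definition douglas_rachford ::
    "('a::real_inner \<Rightarrow> 'a set) \<Rightarrow> ('a \<Rightarrow> 'a set) \<Rightarrow> 'a \<Rightarrow> 'a" where
  "douglas_rachford A B x = x - resolvent A x + resolvent B (reflected_resolvent A x)"

end

theory Submission
  imports Defs
begin

text \<open>
  For \<open>x = a + a'\<close> with \<open>a' \<in> A a\<close>, the vector \<open>x - T x\<close> equals both \<open>a - b\<close> and \<open>a' + b'\<close> for
  some \<open>b' \<in> B b\<close>; hence the range lies in \<open>D \<inter> R\<close>.  Conversely, let \<open>w = p - q = u + v\<close>.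
  The equations \<open>x\<^sub>\<epsilon> - T x\<^sub>\<epsilon> + \<epsilon> x\<^sub>\<epsilon> = w\<close> are solvable because \<open>T\<close> is nonexpansive, and
  \<open>\<epsilon> x\<^sub>\<epsilon> \<rightarrow> 0\<close> as soon as \<open>\<langle>x - (p + u), (x - T x) - w\<rangle>\<close> is bounded below in \<open>x\<close>.  This
  quantity is \<open>\<langle>a - p, a' - u\<rangle> + \<langle>b - q, b' - v\<rangle> + \<parallel>(x - T x) - w\<parallel>\<^sup>2\<close>, and each of
  the first two terms is bounded below if the operator is \<open>3\<^sup>*\<close> monotone or if the reference point
  lies in its graph.

  That resolvents are everywhere defined (Minty's theorem) is proved by minimizing
  \<open>F(x, u) + \<parallel>x\<parallel>\<^sup>2 / 2 + \<parallel>u\<parallel>\<^sup>2 / 2\<close>, where \<open>F\<close> is the Fitzpatrick function of the operator.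
\<close>

section \<open>Minimizing a convex function plus half the squared norm\<close>

text \<open>By strong convexity of the half square, the first components of a minimizing sequence
  are Cauchy. The set \<open>K\<close> is meant to be an epigraph: its closedness stands for lower
  semicontinuity, and points of value \<infinity> are simply absent.\<close>

lemma min_half_norm_square_on_closed_convex:
  fixes K :: "('h::{real_inner, complete_space} \<times> real) set"
  assumes "closed K" and conv: "convex K" and "K \<noteq> {}"
    and bounded_below: "\<And>p t. (p, t) \<in> K \<Longrightarrow> c \<le> t + (p \<bullet> p) / 2"
  obtains p0 t0 where "(p0, t0) \<in> K"
    and "\<And>p t. (p, t) \<in> K \<Longrightarrow> t0 + (p0 \<bullet> p0) / 2 \<le> t + (p \<bullet> p) / 2"
proof -
  define f where "f = (\<lambda>(p::'h, t::real). t + (p \<bullet> p) / 2)"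
  define m where "m = (INF k\<in>K. f k)"
  have bdd: "bdd_below (f ` K)"
    using bounded_below by (intro bdd_belowI2[where m = c]) (auto simp: f_def)
  have m_le: "m \<le> f k" if "k \<in> K" for k
    unfolding m_def using bdd that by (rule cINF_lower)
  have "\<exists>k\<in>K. f k < m + 1 / real (Suc n)" for n
    using cINF_less_iff[OF \<open>K \<noteq> {}\<close> bdd, of "m + 1 / real (Suc n)"] by (simp add: m_def)
  then obtain k where k: "\<And>n. k n \<in> K" "\<And>n. f (k n) < m + 1 / real (Suc n)"
    by metis
  define p t where "p n = fst (k n)" and "t n = snd (k n)" for n
  have pt: "k n = (p n, t n)" for n by (simp add: p_def t_def)
  have parallelogram: "(dist (p i) (p j))\<^sup>2 \<le> 4 * (f (k i) - m) + 4 * (f (k j) - m)" for i j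
  proof -
    \<comment> \<open>At the midpoint, \<open>f\<close> is the average of \<open>f (k i)\<close> and
      \<open>f (k j)\<close> minus one eighth of the squared distance of \<open>p i\<close> and
      \<open>p j\<close>, and it is still at least \<open>m\<close>.\<close>
    have "(1/2) *\<^sub>R k i + (1/2) *\<^sub>R k j \<in> K"
      by (rule convexD[OF conv]) (auto simp: k)
    from m_le[OF this] show ?thesis
      by (simp add: f_def pt dist_norm power2_norm_eq_inner inner_diff_left inner_diff_right
          inner_add_left inner_add_right inner_commute field_simps)
  qed
  have "Cauchy p"
  proof (rule metric_CauchyI)
    fix e :: real assume "0 < e"
    obtain N where N: "1 / real (Suc N) < e\<^sup>2 / 8"
      using nat_approx_posE[of "e\<^sup>2 / 8"] \<open>0 < e\<close> by (metis zero_less_divide_iff zero_less_numeral zero_less_power)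
    have "dist (p i) (p j) < e" if "N \<le> i" "N \<le> j" for i j
    proof -
      have small: "f (k n) - m < e\<^sup>2 / 8" if "N \<le> n" for n
      proof -
        have "1 / real (Suc n) \<le> 1 / real (Suc N)" using that by (simp add: frac_le)
        with k(2)[of n] N show ?thesis by linarith
      qed
      have "(dist (p i) (p j))\<^sup>2 < e\<^sup>2"
        using parallelogram[of i j] small[OF \<open>N \<le> i\<close>] small[OF \<open>N \<le> j\<close>] by argo
      with \<open>0 < e\<close> show ?thesis by (simp add: power2_less_imp_less)
    qed
    then show "\<exists>M. \<forall>i\<ge>M. \<forall>j\<ge>M. dist (p i) (p j) < e" by blast
  qed
  then obtain p0 where p0: "p \<longlonglongrightarrow> p0"
    using Cauchy_convergent convergent_def by blast
  have "(\<lambda>n. f (k n)) \<longlonglongrightarrow> m"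
  proof (rule real_tendsto_sandwich)
    show "\<forall>\<^sub>F n in sequentially. m \<le> f (k n)" using m_le k(1) by simp
    show "\<forall>\<^sub>F n in sequentially. f (k n) \<le> m + 1 / real (Suc n)"
      using k(2) by (simp add: less_imp_le)
    show "(\<lambda>n. m + 1 / real (Suc n)) \<longlonglongrightarrow> m"
      using tendsto_add[OF tendsto_const LIMSEQ_Suc[OF lim_1_over_n]] by simp
  qed simp
  \<comment> \<open>The heights \<open>t n\<close> converge because they are the difference of two
    convergent sequences.\<close>
  then have "(\<lambda>n. f (k n) - (p n \<bullet> p n) / 2) \<longlonglongrightarrow> m - (p0 \<bullet> p0) / 2"
    by (intro tendsto_intros p0) auto
  then have "t \<longlonglongrightarrow> m - (p0 \<bullet> p0) / 2" by (simp add: f_def pt)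
  from tendsto_Pair[OF p0 this] have "k \<longlonglongrightarrow> (p0, m - (p0 \<bullet> p0) / 2)"
    by (simp flip: pt)
  then have "(p0, m - (p0 \<bullet> p0) / 2) \<in> K"
    using \<open>closed K\<close> k(1) closed_sequentially by blast
  moreover have "m - (p0 \<bullet> p0) / 2 + (p0 \<bullet> p0) / 2 \<le> s + (q \<bullet> q) / 2" if "(q, s) \<in> K" for q s
    using m_le[OF that] by (simp add: f_def)
  ultimately show ?thesis using that by blast
qed

text \<open>First-order optimality condition: the one-sided derivative of the objective at the
  minimizer along the segment towards \<open>(p, t)\<close> is nonnegative.\<close>

lemma min_half_norm_square_variational:
  fixes K :: "('h::real_inner \<times> real) set"
  assumes "convex K" and mem: "(p0, t0) \<in> K" "(p, t) \<in> K"
    and min: "\<And>p t. (p, t) \<in> K \<Longrightarrow> t0 + (p0 \<bullet> p0) / 2 \<le> t + (p \<bullet> p) / 2"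
  shows "t0 + p0 \<bullet> p0 \<le> t + p0 \<bullet> p"
proof -
  define d where "d = (t - t0) + p0 \<bullet> (p - p0)"
  define c where "c = ((p - p0) \<bullet> (p - p0)) / 2"
  \<comment> \<open>The objective grows by \<open>s * (d + s * c)\<close> at parameter
    \<open>s\<close>. Dividing by \<open>s\<close> and letting it tend to 0 from the right leaves
    \<open>d\<close>.\<close>
  have "0 \<le> d + s * c" if "0 < s" "s \<le> 1" for s
  proof -
    have "(1 - s) *\<^sub>R (p0, t0) + s *\<^sub>R (p, t) \<in> K"
      using that by (intro convexD[OF \<open>convex K\<close>] mem) auto
    then have "t0 + (p0 \<bullet> p0) / 2 \<le> (1 - s) * t0 + s * t
        + (((1 - s) *\<^sub>R p0 + s *\<^sub>R p) \<bullet> ((1 - s) *\<^sub>R p0 + s *\<^sub>R p)) / 2"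
      using min[of "(1 - s) *\<^sub>R p0 + s *\<^sub>R p" "(1 - s) * t0 + s * t"] by simp
    also have "\<dots> = t0 + (p0 \<bullet> p0) / 2 + s * (d + s * c)"
      by (simp add: d_def c_def inner_diff_left inner_diff_right inner_add_left inner_add_right
          inner_commute field_simps power2_eq_square)
    finally have "0 \<le> s * (d + s * c)" by simp
    with \<open>0 < s\<close> show ?thesis by (simp add: zero_le_mult_iff)
  qed
  then have "\<forall>\<^sub>F s in at_right 0. 0 \<le> d + s * c"
    unfolding eventually_at_right_field by (intro exI[of _ 1]) auto
  moreover have "((\<lambda>s. d + s * c) \<longlongrightarrow> d + 0 * c) (at_right 0)"
    by (intro tendsto_intros)
  ultimately have "0 \<le> d + 0 * c"
    by (intro tendsto_lowerbound) auto
  then show ?thesis by (simp add: d_def inner_diff_right)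
qed

section \<open>Minty's theorem via the Fitzpatrick function\<close>

text \<open>If the regularized Fitzpatrick function is minimal at \<open>(x0, u0)\<close>,
  optimality tested at graph points shows that \<open>(- u0, - x0)\<close> is monotonically related
  to \<open>G\<close>. Maximality puts this point into \<open>G\<close>, and testing optimality
  there forces \<open>x0 = - u0\<close>.\<close>

theorem minty_graph:
  fixes G :: "('a::{real_inner, complete_space} \<times> 'a) set"
  assumes mono: "\<And>x u y v. (x, u) \<in> G \<Longrightarrow> (y, v) \<in> G \<Longrightarrow> 0 \<le> (x - y) \<bullet> (u - v)"
    and maximal: "\<And>x u. (\<And>y v. (y, v) \<in> G \<Longrightarrow> 0 \<le> (x - y) \<bullet> (u - v)) \<Longrightarrow> (x, u) \<in> G"
  shows "\<exists>x. (x, - x) \<in> G"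
proof -
  \<comment> \<open>the epigraph of the Fitzpatrick function of \<open>G\<close>\<close>
  define K where "K = {(p, t). \<forall>(y, v)\<in>G. y \<bullet> snd p + fst p \<bullet> v - y \<bullet> v \<le> t}"
  have K_iff: "((x, u), t) \<in> K \<longleftrightarrow> (\<forall>(y, v)\<in>G. y \<bullet> u + x \<bullet> v - y \<bullet> v \<le> t)" for x u t
    by (simp add: K_def)
  have "K = (\<Inter>(y, v)\<in>G. {k. y \<bullet> snd (fst k) + fst (fst k) \<bullet> v - y \<bullet> v \<le> snd k})"
    by (auto simp: K_def)
  then have "closed K"
    by (auto intro!: closed_INT closed_Collect_le continuous_intros)
  have "convex K"
  proof (rule convexI)
    fix k l :: "('a \<times> 'a) \<times> real" and r s :: real
    assume kl: "k \<in> K" "l \<in> K" and rs: "0 \<le> r" "0 \<le> s" "r + s = 1"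
    obtain x u t x' u' t' where [simp]: "k = ((x, u), t)" "l = ((x', u'), t')"
      by (metis surj_pair)
    have "y \<bullet> (r *\<^sub>R u + s *\<^sub>R u') + (r *\<^sub>R x + s *\<^sub>R x') \<bullet> v - y \<bullet> v \<le> r * t + s * t'"
      if "(y, v) \<in> G" for y v
    proof -
      have "y \<bullet> (r *\<^sub>R u + s *\<^sub>R u') + (r *\<^sub>R x + s *\<^sub>R x') \<bullet> v - (r + s) * (y \<bullet> v)
          = r * (y \<bullet> u + x \<bullet> v - y \<bullet> v) + s * (y \<bullet> u' + x' \<bullet> v - y \<bullet> v)"
        by (simp add: inner_add_left inner_add_right algebra_simps)
      also have "\<dots> \<le> r * t + s * t'"
        using kl that rs by (intro add_mono mult_left_mono) (auto simp: K_iff)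
      finally show ?thesis using rs by simp
    qed
    then show "r *\<^sub>R k + s *\<^sub>R l \<in> K" by (auto simp: K_iff)
  qed
  have graph_K: "((x, u), x \<bullet> u) \<in> K" if "(x, u) \<in> G" for x u
    unfolding K_iff
  proof clarify
    fix y v assume "(y, v) \<in> G"
    from mono[OF that this] show "y \<bullet> u + x \<bullet> v - y \<bullet> v \<le> x \<bullet> u"
      by (simp add: inner_diff_left inner_diff_right)
  qed
  have "G \<noteq> {}" using maximal[of 0 0] by blast
  then have "K \<noteq> {}" using graph_K by fastforce
  \<comment> \<open>A value below \<open>x \<bullet> u\<close> would make \<open>(x, u)\<close>
    monotonically related to \<open>G\<close>, hence a member of it; the epigraph inequality at
    \<open>(x, u)\<close> itself then gives a contradiction.\<close>
  have Fitzpatrick: "x \<bullet> u \<le> t" if "((x, u), t) \<in> K" for x u t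
  proof (rule ccontr)
    assume "\<not> x \<bullet> u \<le> t"
    have "(x, u) \<in> G"
    proof (rule maximal)
      fix y v assume "(y, v) \<in> G"
      with that have "y \<bullet> u + x \<bullet> v - y \<bullet> v \<le> t" by (auto simp: K_iff)
      with \<open>\<not> x \<bullet> u \<le> t\<close> show "0 \<le> (x - y) \<bullet> (u - v)"
        by (simp add: inner_diff_left inner_diff_right)
    qed
    with that \<open>\<not> x \<bullet> u \<le> t\<close> show False by (auto simp: K_iff)
  qed
  have half_square: "((x + u) \<bullet> (x + u)) / 2 = (x \<bullet> x + u \<bullet> u) / 2 + x \<bullet> u" for x u :: 'a
    by (simp add: inner_add_left inner_add_right inner_commute)
  have nonneg: "0 \<le> t + (p \<bullet> p) / 2" if "(p, t) \<in> K" for p t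
  proof -
    obtain x u where p: "p = (x, u)" by fastforce
    have "0 \<le> ((x + u) \<bullet> (x + u)) / 2" by simp
    also note half_square
    also have "x \<bullet> u \<le> t" using Fitzpatrick that by (simp add: p)
    finally show ?thesis by (simp add: p inner_Pair add.commute)
  qed
  obtain p0 t0 where mem: "(p0, t0) \<in> K"
    and min: "\<And>p t. (p, t) \<in> K \<Longrightarrow> t0 + (p0 \<bullet> p0) / 2 \<le> t + (p \<bullet> p) / 2"
    using min_half_norm_square_on_closed_convex[OF \<open>closed K\<close> \<open>convex K\<close> \<open>K \<noteq> {}\<close> nonneg] by metis
  obtain x0 u0 where p0: "p0 = (x0, u0)" by fastforce
  have key: "((x0 + u0) \<bullet> (x0 + u0)) / 2 \<le> (x + u0) \<bullet> (u + x0)" if "(x, u) \<in> G" for x u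
    using min_half_norm_square_variational[OF \<open>convex K\<close> mem graph_K[OF that] min] nonneg[OF mem]
      half_square[of x0 u0]
    by (simp add: p0 inner_add_left inner_add_right inner_commute) argo
  have "(- u0, - x0) \<in> G"
  proof (rule maximal)
    fix y v assume "(y, v) \<in> G"
    from key[OF this] have "0 \<le> (y + u0) \<bullet> (v + x0)"
      by (rule order_trans[rotated]) simp
    also have "\<dots> = (- u0 - y) \<bullet> (- x0 - v)"
      by (simp add: inner_diff_left inner_diff_right inner_add_left inner_add_right)
    finally show "0 \<le> (- u0 - y) \<bullet> (- x0 - v)" .
  qed
  \<comment> \<open>At the point \<open>(- u0, - x0)\<close> the right-hand side of
    \<open>key\<close> vanishes.\<close>
  moreover from key[OF this] have "(x0 + u0) \<bullet> (x0 + u0) = 0"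
    using inner_ge_zero[of "x0 + u0"] by simp
  then have "x0 = - u0" by (simp add: eq_neg_iff_add_eq_0)
  ultimately have "(- u0, - (- u0)) \<in> G" by simp
  then show ?thesis by (rule exI)
qed

section \<open>Maximal monotonicity and resolvents\<close>

lemma monotone_opD:
  "monotone_op C \<Longrightarrow> u \<in> C x \<Longrightarrow> v \<in> C y \<Longrightarrow> 0 \<le> (x - y) \<bullet> (u - v)"
  by (auto simp: monotone_op_def op_graph_def)

text \<open>Otherwise adjoining the single point \<open>(x, u)\<close> to the graph would give a
  proper monotone extension.\<close>

lemma maximally_monotone_opD:
  assumes "maximally_monotone_op C"
    and related: "\<And>y v. v \<in> C y \<Longrightarrow> 0 \<le> (x - y) \<bullet> (u - v)"
  shows "u \<in> C x"
proof (rule ccontr)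
  assume "u \<notin> C x"
  define E where "E = C(x := insert u (C x))"
  have mono: "monotone_op C" using assms(1) by (simp add: maximally_monotone_op_def)
  have related': "0 \<le> (y - x) \<bullet> (v - u)" if "v \<in> C y" for y v
    using related[OF that] by (simp add: inner_diff_left inner_diff_right)
  have graph_E: "op_graph E = insert (x, u) (op_graph C)"
    by (auto simp: E_def op_graph_def split: if_splits)
  then have "monotone_op E"
    using mono related related' by (auto simp: monotone_op_def graph_E) (auto simp: op_graph_def)
  moreover have "op_graph C \<subset> op_graph E"
    using \<open>u \<notin> C x\<close> graph_E by (auto simp: op_graph_def)
  ultimately show False using assms(1) by (auto simp: maximally_monotone_op_def)
qed

theorem minty:
  fixes C :: "'a::{real_inner, complete_space} \<Rightarrow> 'a set"
  assumes "maximally_monotone_op C"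
  shows "\<exists>y. z - y \<in> C y"
proof -
  \<comment> \<open>Translating all values by \<open>- z\<close> keeps the graph maximally monotone,
    and a point \<open>(x, - x)\<close> of the translate means
    \<open>z - x \<in> C x\<close>.\<close>
  define G where "G = {(x, u). u + z \<in> C x}"
  have mono: "monotone_op C" using assms by (simp add: maximally_monotone_op_def)
  have "\<exists>x. (x, - x) \<in> G"
  proof (rule minty_graph)
    show "0 \<le> (x - y) \<bullet> (u - v)" if "(x, u) \<in> G" "(y, v) \<in> G" for x u y v
      using monotone_opD[OF mono, of "u + z" x "v + z" y] that by (simp add: G_def)
  next
    fix x u assume *: "\<And>y v. (y, v) \<in> G \<Longrightarrow> 0 \<le> (x - y) \<bullet> (u - v)"
    have "u + z \<in> C x"
    proof (rule maximally_monotone_opD[OF assms])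
      show "0 \<le> (x - y) \<bullet> (u + z - v)" if "v \<in> C y" for y v
        using *[of y "v - z"] that by (simp add: G_def algebra_simps)
    qed
    then show "(x, u) \<in> G" by (simp add: G_def)
  qed
  then show ?thesis by (auto simp: G_def)
qed

lemma resolvent_mem:
  fixes C :: "'a::{real_inner, complete_space} \<Rightarrow> 'a set"
  assumes "maximally_monotone_op C"
  shows "x - resolvent C x \<in> C (resolvent C x)"
proof -
  have mono: "monotone_op C" using assms by (simp add: maximally_monotone_op_def)
  have iff: "y \<in> op_inverse (\<lambda>w. {w} + C w) x \<longleftrightarrow> x - y \<in> C y" for y
    by (force simp: op_inverse_def set_plus_def)
  have "\<exists>!y. x - y \<in> C y"
  proof (rule ex_ex1I)
    show "\<exists>y. x - y \<in> C y" using assms by (rule minty)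
    fix y y' assume "x - y \<in> C y" "x - y' \<in> C y'"
    then have "0 \<le> (y - y') \<bullet> ((x - y) - (x - y'))" by (rule monotone_opD[OF mono])
    also have "\<dots> = - ((y - y') \<bullet> (y - y'))" by (simp add: inner_diff_left inner_diff_right)
    finally have "(y - y') \<bullet> (y - y') = 0" using inner_ge_zero[of "y - y'"] by linarith
    then show "y = y'" by simp
  qed
  then show ?thesis unfolding resolvent_def iff by (rule theI')
qed

section \<open>The Douglas-Rachford operator\<close>

text \<open>With \<open>a\<close> the resolvent of \<open>A\<close> at \<open>x\<close> and
  \<open>a' = x - a\<close>, the reflected resolvent is \<open>a - a'\<close>; resolving this point
  by \<open>B\<close> splits it as \<open>b + b'\<close>.\<close>

lemma douglas_rachford_decompose:
  fixes A B :: "'a::{real_inner, complete_space} \<Rightarrow> 'a set"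
  assumes "maximally_monotone_op A" "maximally_monotone_op B"
  obtains a a' b b' where "a' \<in> A a" "b' \<in> B b" "x = a + a'"
    "x - douglas_rachford A B x = a - b" "a - b = a' + b'"
proof
  let ?a = "resolvent A x"
  let ?b = "resolvent B (reflected_resolvent A x)"
  show "x - ?a \<in> A ?a" "reflected_resolvent A x - ?b \<in> B ?b"
    using assms by (auto intro: resolvent_mem)
qed (simp_all add: douglas_rachford_def reflected_resolvent_def scaleR_2)

text \<open>It is applied to differences of two such decompositions, where the first two terms on
  the right become the monotonicity pairings of \<open>A\<close> and \<open>B\<close>.\<close>

lemma inner_sum_identity:
  fixes a a' b b' :: "'a::real_inner"
  assumes "a - b = a' + b'"
  shows "(a + a') \<bullet> (a - b) = a \<bullet> a' + b \<bullet> b' + (a - b) \<bullet> (a - b)"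
proof -
  have "b' = a - b - a'" using assms by (simp add: algebra_simps)
  then show ?thesis
    by (simp add: inner_diff_left inner_diff_right inner_add_left inner_add_right inner_commute)
qed

text \<open>The identity makes the displacement \<open>x - T x\<close> firmly nonexpansive: its
  increment \<open>e\<close> satisfies \<open>e \<bullet> e \<le> (x - y) \<bullet> e\<close>.
  Expanding the square of \<open>(x - y) - e\<close> finishes.\<close>

lemma douglas_rachford_nonexpansive:
  fixes A B :: "'a::{real_inner, complete_space} \<Rightarrow> 'a set"
  assumes "maximally_monotone_op A" "maximally_monotone_op B"
  shows "dist (douglas_rachford A B x) (douglas_rachford A B y) \<le> dist x y"
proof -
  have mono: "monotone_op A" "monotone_op B"
    using assms by (auto simp: maximally_monotone_op_def)
  let ?T = "douglas_rachford A B"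
  obtain a a' b b' where x: "a' \<in> A a" "b' \<in> B b" "x = a + a'" "x - ?T x = a - b" "a - b = a' + b'"
    using assms by (rule douglas_rachford_decompose)
  obtain c c' d d' where y: "c' \<in> A c" "d' \<in> B d" "y = c + c'" "y - ?T y = c - d" "c - d = c' + d'"
    using assms by (rule douglas_rachford_decompose)
  define e where "e = (a - c) - (b - d)"
  have "(a - c + (a' - c')) \<bullet> e = (a - c) \<bullet> (a' - c') + (b - d) \<bullet> (b' - d') + e \<bullet> e"
    unfolding e_def using x(5) y(5) by (intro inner_sum_identity) (simp add: algebra_simps)
  moreover have "x - y = a - c + (a' - c')" using x(3) y(3) by simp
  ultimately have "e \<bullet> e \<le> (x - y) \<bullet> e"
    using monotone_opD[OF mono(1) x(1) y(1)] monotone_opD[OF mono(2) x(2) y(2)] by simp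
  moreover have "0 \<le> e \<bullet> e" by simp
  moreover have T: "?T x - ?T y = (x - y) - e"
    using x(4) y(4) by (simp add: e_def algebra_simps)
  ultimately have "(?T x - ?T y) \<bullet> (?T x - ?T y) \<le> (x - y) \<bullet> (x - y)"
    unfolding T inner_diff_left[of _ e] inner_diff_right[of _ _ e] inner_commute[of e "x - y"]
    by linarith
  then show ?thesis by (simp add: dist_norm norm_le)
qed

section \<open>Displacements of nonexpansive maps\<close>

text \<open>Solving for \<open>x\<close> turns the equation into a fixed-point problem for a
  contraction with constant \<open>1 / (1 + e)\<close>.\<close>

lemma nonexpansive_displacement_surj:
  fixes T :: "'a::{real_normed_vector, complete_space} \<Rightarrow> 'a"
  assumes "\<And>x y. dist (T x) (T y) \<le> dist x y" and "0 < e"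
  shows "\<exists>x. x - T x + e *\<^sub>R x = w"
proof -
  define g where "g x = (1 / (1 + e)) *\<^sub>R (T x + w)" for x
  have "dist (g x) (g y) \<le> 1 / (1 + e) * dist x y" for x y
  proof -
    have "dist (g x) (g y) = 1 / (1 + e) * dist (T x) (T y)"
      using \<open>0 < e\<close> by (simp add: g_def dist_norm flip: scaleR_diff_right)
    also have "\<dots> \<le> 1 / (1 + e) * dist x y"
      using assms by (intro mult_left_mono) auto
    finally show ?thesis .
  qed
  then have "\<exists>!x. g x = x"
    using \<open>0 < e\<close> by (intro banach_fix_type[of "1 / (1 + e)"]) auto
  then obtain x where "x = (1 / (1 + e)) *\<^sub>R (T x + w)" by (metis g_def)
  then have "(1 + e) *\<^sub>R x = (1 + e) *\<^sub>R (1 / (1 + e)) *\<^sub>R (T x + w)" by simp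
  also have "\<dots> = T x + w" using \<open>0 < e\<close> by simp
  finally show ?thesis by (intro exI[of _ x]) (simp add: algebra_simps)
qed

lemma displacement_closure:
  fixes T :: "'a::{real_inner, complete_space} \<Rightarrow> 'a"
  assumes T: "\<And>x y. dist (T x) (T y) \<le> dist x y"
    and bound: "\<And>x. c \<le> (x - z) \<bullet> ((x - T x) - w)"
  shows "w \<in> closure (range (\<lambda>x. x - T x))"
proof -
  define e where "e n = 1 / real (Suc n)" for n
  have e: "0 < e n" for n by (simp add: e_def)
  have e_lim: "e \<longlonglongrightarrow> 0" unfolding e_def by (rule LIMSEQ_Suc[OF lim_1_over_n])
  have "\<forall>n. \<exists>x. x - T x + e n *\<^sub>R x = w"
    using nonexpansive_displacement_surj[of T, OF T e] by blast
  then obtain x where x: "\<And>n. x n - T (x n) + e n *\<^sub>R x n = w"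
    by metis
  have disp: "x n - T (x n) = w - e n *\<^sub>R x n" for n
    using x[of n] by (simp add: algebra_simps)
  define y where "y n = e n *\<^sub>R x n" for n
  \<comment> \<open>Multiplying \<open>bound\<close> by \<open>e n\<close> bounds the square of
    \<open>y n\<close> by \<open>(e n *\<^sub>R z) \<bullet> y n - e n * c\<close>; the mixed term
    is absorbed by \<open>2 * (r \<bullet> s) \<le> r \<bullet> r + s \<bullet> s\<close>.\<close>
  have est: "(norm (y n))\<^sup>2 \<le> e n * (z \<bullet> z * e n - 2 * c)" for n
  proof -
    have "c \<le> - (e n * ((x n - z) \<bullet> x n))" using bound[of "x n"] by (simp add: disp)
    then have "e n * ((x n - z) \<bullet> x n) \<le> - c" by simp
    then have "e n * (e n * ((x n - z) \<bullet> x n)) \<le> e n * (- c)"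
      using e[of n] by (intro mult_left_mono) auto
    moreover have "e n * (e n * ((x n - z) \<bullet> x n)) = y n \<bullet> y n - (e n *\<^sub>R z) \<bullet> y n"
      by (simp add: y_def inner_diff_left algebra_simps)
    moreover have "0 \<le> (y n - e n *\<^sub>R z) \<bullet> (y n - e n *\<^sub>R z)" by simp
    ultimately show ?thesis
      by (simp add: power2_norm_eq_inner inner_diff_left inner_diff_right inner_commute algebra_simps)
  qed
  have "(\<lambda>n. e n * (z \<bullet> z * e n - 2 * c)) \<longlonglongrightarrow> 0 * (z \<bullet> z * 0 - 2 * c)"
    by (intro tendsto_intros e_lim)
  then have bound_lim: "(\<lambda>n. e n * (z \<bullet> z * e n - 2 * c)) \<longlonglongrightarrow> 0" by simp
  have "(\<lambda>n. (norm (y n))\<^sup>2) \<longlonglongrightarrow> 0"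
    by (rule Lim_null_comparison[OF _ bound_lim]) (simp add: est)
  from tendsto_real_sqrt[OF this] have "(\<lambda>n. norm (y n)) \<longlonglongrightarrow> 0" by simp
  then have "y \<longlonglongrightarrow> 0" by (rule tendsto_norm_zero_cancel)
  then have "(\<lambda>n. w - y n) \<longlonglongrightarrow> w - 0" by (intro tendsto_intros)
  then have "(\<lambda>n. x n - T (x n)) \<longlonglongrightarrow> w" by (simp only: disp y_def diff_zero)
  then show ?thesis
    unfolding closure_sequential by (intro exI[of _ "\<lambda>n. x n - T (x n)"]) simp
qed

section \<open>Points at which the pairing is bounded below\<close>

text \<open>Equivalently, the Fitzpatrick function of \<open>C\<close> is not \<infinity> at
  \<open>(p, u)\<close>. The notion treats graph points and points supplied by 3* monotonicity
  alike.\<close>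

definition pairing_bounded_below :: "('a::real_inner \<Rightarrow> 'a set) \<Rightarrow> 'a \<Rightarrow> 'a \<Rightarrow> bool" where
  "pairing_bounded_below C p u \<longleftrightarrow> (\<exists>c. \<forall>x. \<forall>v \<in> C x. c \<le> (x - p) \<bullet> (v - u))"

lemma pairing_bounded_below_graph:
  "monotone_op C \<Longrightarrow> u \<in> C p \<Longrightarrow> pairing_bounded_below C p u"
  unfolding pairing_bounded_below_def by (meson monotone_opD)

lemma pairing_bounded_below_three_star:
  assumes "three_star_monotone_op C" "p \<in> op_dom C" "u \<in> op_ran C"
  shows "pairing_bounded_below C p u"
proof -
  have "- \<infinity> < (INF (x, v) \<in> op_graph C. ereal ((x - p) \<bullet> (v - u)))"
    using assms by (auto simp: three_star_monotone_op_def)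
  then obtain c where c: "ereal c < (INF (x, v) \<in> op_graph C. ereal ((x - p) \<bullet> (v - u)))"
    using ereal_dense2 by blast
  have "c \<le> (x - p) \<bullet> (v - u)" if "v \<in> C x" for x v
  proof -
    have "(INF (x, v) \<in> op_graph C. ereal ((x - p) \<bullet> (v - u))) \<le> ereal ((x - p) \<bullet> (v - u))"
      using INF_lower[of "(x, v)" "op_graph C" "\<lambda>(x, v). ereal ((x - p) \<bullet> (v - u))"] that
      by (simp add: op_graph_def)
    with c have "ereal c < ereal ((x - p) \<bullet> (v - u))" by (rule less_le_trans)
    then show ?thesis by simp
  qed
  then show ?thesis by (auto simp: pairing_bounded_below_def)
qed

lemma mem_closure_range_displacement:
  fixes A B :: "'a::{real_inner, complete_space} \<Rightarrow> 'a set"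
  assumes "maximally_monotone_op A" "maximally_monotone_op B"
    and "pairing_bounded_below A p u" "pairing_bounded_below B q v"
    and "w = p - q" "w = u + v"
  shows "w \<in> closure (range (\<lambda>x. x - douglas_rachford A B x))"
proof -
  obtain cA where cA: "\<And>a a'. a' \<in> A a \<Longrightarrow> cA \<le> (a - p) \<bullet> (a' - u)"
    using assms(3) by (auto simp: pairing_bounded_below_def)
  obtain cB where cB: "\<And>b b'. b' \<in> B b \<Longrightarrow> cB \<le> (b - q) \<bullet> (b' - v)"
    using assms(4) by (auto simp: pairing_bounded_below_def)
  have "cA + cB \<le> (x - (p + u)) \<bullet> ((x - douglas_rachford A B x) - w)" for x
  proof -
    obtain a a' b b' where x: "a' \<in> A a" "b' \<in> B b" "x = a + a'"
      "x - douglas_rachford A B x = a - b" "a - b = a' + b'"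
      using assms(1,2) by (rule douglas_rachford_decompose)
    \<comment> \<open>Because \<open>w\<close> equals both \<open>p - q\<close> and
      \<open>u + v\<close>, \<open>d\<close> is also \<open>(a' - u) + (b' - v)\<close>, as the
      identity requires.\<close>
    define d where "d = (a - p) - (b - q)"
    have "(a - p + (a' - u)) \<bullet> d = (a - p) \<bullet> (a' - u) + (b - q) \<bullet> (b' - v) + d \<bullet> d"
      unfolding d_def using x(5) assms(5,6) by (intro inner_sum_identity) (simp add: algebra_simps)
    moreover have "x - (p + u) = a - p + (a' - u)" using x(3) by simp
    moreover have "(x - douglas_rachford A B x) - w = d" using x(4) assms(5) by (simp add: d_def)
    moreover have "0 \<le> d \<bullet> d" by simp
    ultimately show ?thesis using cA[OF x(1)] cB[OF x(2)] by (simp only:)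
  qed
  then show ?thesis
    by (rule displacement_closure[OF douglas_rachford_nonexpansive[OF assms(1,2)]])
qed

section \<open>The range inclusion and the three closure formulas\<close>

lemma op_dom_iff: "x \<in> op_dom C \<longleftrightarrow> (\<exists>u. u \<in> C x)"
  by (auto simp: op_dom_def)

lemma op_ran_iff: "u \<in> op_ran C \<longleftrightarrow> (\<exists>x. u \<in> C x)"
  by (auto simp: op_ran_def)

lemma range_displacement_subset:
  fixes A B :: "'a::{real_inner, complete_space} \<Rightarrow> 'a set"
  assumes "maximally_monotone_op A" "maximally_monotone_op B"
  shows "range (\<lambda>x. x - douglas_rachford A B x)
    \<subseteq> minkowski_diff (op_dom A) (op_dom B) \<inter> (op_ran A + op_ran B)"
proof clarify
  fix x
  obtain a a' b b' where x: "a' \<in> A a" "b' \<in> B b" "x - douglas_rachford A B x = a - b" "a - b = a' + b'"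
    using assms by (rule douglas_rachford_decompose)
  then have "a \<in> op_dom A" "b \<in> op_dom B" "a' \<in> op_ran A" "b' \<in> op_ran B"
    by (auto simp: op_dom_iff op_ran_iff)
  then show "x - douglas_rachford A B x
      \<in> minkowski_diff (op_dom A) (op_dom B) \<inter> (op_ran A + op_ran B)"
    unfolding minkowski_diff_def using x(3,4) by (metis (mono_tags, lifting) CollectI IntI set_plus_intro)
qed

theorem theorem2p5:
  fixes A B :: "'a::{real_inner, complete_space} \<Rightarrow> 'a set"
    and T :: "'a \<Rightarrow> 'a" and D R :: "'a set"
  assumes "maximally_monotone_op A" and "maximally_monotone_op B"
    and "T = douglas_rachford A B"
    and "D = minkowski_diff (op_dom A) (op_dom B)"
    and "R = op_ran A + op_ran B"
  shows "(three_star_monotone_op A \<and> three_star_monotone_op B \<longrightarrow>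
            closure (range (\<lambda>x. x - T x)) = closure (D \<inter> R)) \<and>
         ((\<exists>C\<in>{A, B}. op_dom C = UNIV \<and> three_star_monotone_op C) \<longrightarrow>
            closure (range (\<lambda>x. x - T x)) = closure R) \<and>
         ((\<exists>C\<in>{A, B}. op_ran C = UNIV \<and> three_star_monotone_op C) \<longrightarrow>
            closure (range (\<lambda>x. x - T x)) = closure D)"
proof -
  have mono: "monotone_op A" "monotone_op B"
    using assms(1,2) by (auto simp: maximally_monotone_op_def)
  let ?Ran = "range (\<lambda>x. x - T x)"
  have sub: "?Ran \<subseteq> D \<inter> R"
    using range_displacement_subset[OF assms(1,2)] by (simp add: assms(3-5))
  have closure_eq: "closure ?Ran = closure S" if "?Ran \<subseteq> S" "S \<subseteq> closure ?Ran" for S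
    using that by (metis closure_closure closure_mono subset_antisym)
  have mem: "w \<in> closure ?Ran"
    if "pairing_bounded_below A p u" "pairing_bounded_below B q v" "w = p - q" "w = u + v"
    for w p q u v
    unfolding assms(3) using assms(1,2) that by (rule mem_closure_range_displacement)
  note graph = pairing_bounded_below_graph[OF mono(1)] pairing_bounded_below_graph[OF mono(2)]
  note star = pairing_bounded_below_three_star
  have D_elim: "\<exists>p q. p \<in> op_dom A \<and> q \<in> op_dom B \<and> w = p - q" if "w \<in> D" for w
    using that by (auto simp: assms(4) minkowski_diff_def)
  have R_elim: "\<exists>u v. u \<in> op_ran A \<and> v \<in> op_ran B \<and> w = u + v" if "w \<in> R" for w
    using that by (auto simp: assms(5) set_plus_def)
  have i: "closure ?Ran = closure (D \<inter> R)"
    if "three_star_monotone_op A" "three_star_monotone_op B"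
  proof (rule closure_eq[OF sub], rule subsetI)
    fix w assume "w \<in> D \<inter> R"
    then show "w \<in> closure ?Ran" using D_elim[of w] R_elim[of w] that by (blast intro: mem star)
  qed
  have ii: "closure ?Ran = closure R"
    if "C \<in> {A, B}" "op_dom C = UNIV" "three_star_monotone_op C" for C
  proof (rule closure_eq, use sub in blast, rule subsetI)
    fix w assume "w \<in> R"
    then obtain u v where uv: "u \<in> op_ran A" "v \<in> op_ran B" "w = u + v" using R_elim by blast
    then obtain p q where pq: "u \<in> A p" "v \<in> B q" by (auto simp: op_ran_iff)
    from that(1) consider "C = A" | "C = B" by blast
    then show "w \<in> closure ?Ran"
    proof cases
      case 1
      \<comment> \<open>The point \<open>(q, v)\<close> lies in the graph of \<open>B\<close>. The
        remaining \<open>p\<close> is forced to be \<open>w + q\<close>, which full domain of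
        \<open>A\<close> permits; 3* monotonicity then handles \<open>(w + q, u)\<close>, which may
        lie off the graph.\<close>
      show ?thesis
        by (rule mem[where p = "w + q" and u = u and q = q and v = v])
          (use uv pq that 1 in \<open>auto intro: star graph\<close>)
    next
      case 2
      show ?thesis
        by (rule mem[where p = p and u = u and q = "p - w" and v = v])
          (use uv pq that 2 in \<open>auto intro: star graph\<close>)
    qed
  qed
  have iii: "closure ?Ran = closure D"
    if "C \<in> {A, B}" "op_ran C = UNIV" "three_star_monotone_op C" for C
  proof (rule closure_eq, use sub in blast, rule subsetI)
    fix w assume "w \<in> D"
    then obtain p q where pq: "p \<in> op_dom A" "q \<in> op_dom B" "w = p - q" using D_elim by blast
    then obtain u v where uv: "u \<in> A p" "v \<in> B q" by (auto simp: op_dom_iff)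
    from that(1) consider "C = A" | "C = B" by blast
    then show "w \<in> closure ?Ran"
    proof cases
      case 1
      \<comment> \<open>Dually, \<open>(q, v)\<close> is again a graph point of \<open>B\<close>,
        and full range of \<open>A\<close> permits the forced value \<open>w - v\<close>.\<close>
      show ?thesis
        by (rule mem[where p = p and u = "w - v" and q = q and v = v])
          (use uv pq that 1 in \<open>auto intro: star graph\<close>)
    next
      case 2
      show ?thesis
        by (rule mem[where p = p and u = u and q = q and v = "w - u"])
          (use uv pq that 2 in \<open>auto intro: star graph\<close>)
    qed
  qed
  show ?thesis by (intro conjI impI; elim conjE bexE) (fact i ii iii)+
qed

end
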